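(* Assume that $\mu(\boldsymbol{\theta})\ge\mu_*>0$ for all $\boldsymbol{\theta}\in\Theta$. For $\mathfrak{z}>0$ let $\mathcal{E}(\mathfrak{z})=\{\boldsymbol{\theta}\in\Theta:L(\widetilde{\boldsymbol{\theta}},\boldsymbol{\theta})\le\mathfrak{z}\}$. Then for any $\mathfrak{z}>0$ and any $\rho\in[0,1)$, $$\mathbb{P}\big(\boldsymbol{\theta}_0\notin\mathcal{E}(\mathfrak{z})\big)\le\mathfrak{Q}(\rho,0)\exp\{-\rho\mu_*\mathfrak{z}\}.$$
   Context: $L(\boldsymbol{\theta})$, $\boldsymbol{\theta}\in\Theta\subset\mathbb{R}^p$, is a separable real-valued random field on a probability space $(\Omega,\mathcal{F},\mathbb{P})$ with expectation $\mathbb{E}$, and $\mathbb{E}L(\boldsymbol{\theta})$ exists for all $\boldsymbol{\theta}\in\Theta$. Notation: $L(\boldsymbol{\theta},\boldsymbol{\theta}')=L(\boldsymbol{\theta})-L(\boldsymbol{\theta}')$. The point $\boldsymbol{\theta}_0\in\Theta$ is a maximizer of $\boldsymbol{\theta}\mapsto\mathbb{E}L(\boldsymbol{\theta})$, and the (random) minimum contrast estimator $\widetilde{\boldsymbol{\theta}}\in\Theta$ is a maximizer of $\boldsymbol{\theta}\mapsto L(\boldsymbol{\theta})$ over $\Theta$. It is assumed that for every $\boldsymbol{\theta}\in\Theta$ the set $\Upsilon(\boldsymbol{\theta})=\{\mu\in(0,\infty):\mathbb{E}\exp\{\mu L(\boldsymbol{\theta},\boldsymbol{\theta}_0)\}<\infty\}$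 is non-empty; a function $\mu(\cdot)$ with $\mu(\boldsymbol{\theta})\in\Upsilon(\boldsymbol{\theta})$ is fixed, and $\mathfrak{M}(\boldsymbol{\theta},\boldsymbol{\theta}_0)=-\log\mathbb{E}\exp\{\mu(\boldsymbol{\theta})L(\boldsymbol{\theta},\boldsymbol{\theta}_0)\}$. For $\rho,s\in[0,1]$, $$\mathfrak{Q}(\rho,s)=\mathbb{E}\sup_{\boldsymbol{\theta}\in\Theta}\exp\Big\{\rho\big[\mu(\boldsymbol{\theta})L(\boldsymbol{\theta},\boldsymbol{\theta}_0)+s\,\mathfrak{M}(\boldsymbol{\theta},\boldsymbol{\theta}_0)\big]\Big\}.$$ *)

theory Defs
  imports "HOL-Probability.Probability"
begin

text \<open>
  Separability is rendered in its sequential form: outside a null set, the graph of the field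
  over \<open>\<Theta>\<close> lies in the closure of its graph over a countable set \<open>D \<subseteq> \<Theta>\<close> (which is then
  automatically dense in \<open>\<Theta>\<close>).
\<close>

definition separable_random_field ::
  "'w measure \<Rightarrow> 'a::topological_space set \<Rightarrow> ('a \<Rightarrow> 'w \<Rightarrow> real) \<Rightarrow> bool" where
  "separable_random_field M \<Theta> L \<longleftrightarrow>
     (\<forall>\<theta>\<in>\<Theta>. L \<theta> \<in> borel_measurable M) \<and>
     (\<exists>D. countable D \<and> D \<subseteq> \<Theta> \<and>
        (AE \<omega> in M. \<forall>\<theta>\<in>\<Theta>. \<exists>d. (\<forall>n::nat. d n \<in> D) \<and> d \<longlonglongrightarrow> \<theta> \<and>
           (\<lambda>n. L (d n) \<omega>) \<longlonglongrightarrow> L \<theta> \<omega>))"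

definition contrast_diff :: "('a \<Rightarrow> 'w \<Rightarrow> real) \<Rightarrow> 'a \<Rightarrow> 'a \<Rightarrow> 'w \<Rightarrow> real" where
  "contrast_diff L \<theta> \<theta>' \<omega> = L \<theta> \<omega> - L \<theta>' \<omega>"

definition Upsilon :: "'w measure \<Rightarrow> ('a \<Rightarrow> 'w \<Rightarrow> real) \<Rightarrow> 'a \<Rightarrow> 'a \<Rightarrow> real set" where
  "Upsilon M L \<theta>0 \<theta> =
     {m. 0 < m \<and> (\<integral>\<^sup>+\<omega>. ennreal (exp (m * contrast_diff L \<theta> \<theta>0 \<omega>)) \<partial>M) < \<infinity>}"

definition rate_fun ::
  "'w measure \<Rightarrow> ('a \<Rightarrow> 'w \<Rightarrow> real) \<Rightarrow> ('a \<Rightarrow> real) \<Rightarrow> 'a \<Rightarrow> 'a \<Rightarrow> real" where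
  "rate_fun M L \<mu> \<theta> \<theta>0 = - ln (\<integral>\<omega>. exp (\<mu> \<theta> * contrast_diff L \<theta> \<theta>0 \<omega>) \<partial>M)"

text \<open>
  The value may be infinite. As \<open>\<mu>\<close> is an arbitrary selection from \<open>Upsilon\<close>, the supremum need
  not be measurable; the integral is then the lower integral (the supremum over measurable
  minorants), which is the smallest possible reading.
\<close>

definition Q_bound ::
  "'w measure \<Rightarrow> 'a set \<Rightarrow> ('a \<Rightarrow> 'w \<Rightarrow> real) \<Rightarrow> ('a \<Rightarrow> real) \<Rightarrow> 'a \<Rightarrow> real \<Rightarrow> real \<Rightarrow> ennreal" where
  "Q_bound M \<Theta> L \<mu> \<theta>0 \<rho> s =
     (\<integral>\<^sup>+\<omega>. (SUP \<theta>\<in>\<Theta>. ennreal (exp (\<rho> *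
        (\<mu> \<theta> * contrast_diff L \<theta> \<theta>0 \<omega> + s * rate_fun M L \<mu> \<theta> \<theta>0)))) \<partial>M)"

definition conf_set ::
  "'a set \<Rightarrow> ('a \<Rightarrow> 'w \<Rightarrow> real) \<Rightarrow> ('w \<Rightarrow> 'a) \<Rightarrow> real \<Rightarrow> 'w \<Rightarrow> 'a set" where
  "conf_set \<Theta> L \<theta>t z \<omega> = {\<theta>\<in>\<Theta>. contrast_diff L (\<theta>t \<omega>) \<theta> \<omega> \<le> z}"

text \<open>
  In statements about \<open>conf_set\<close>, probabilities are taken in \<open>completion M\<close>: separability only
  makes \<open>\<omega> \<mapsto> L (\<theta>t \<omega>) \<omega>\<close> measurable up to a null set, and \<open>emeasure M\<close> is \<open>0\<close> on sets that
  are not measurable.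
\<close>

end

theory Submission
  imports Defs
begin

text \<open>
  On the event that \<open>\<theta>0\<close> is left out of the confidence set, the excess
  \<open>L \<theta> \<omega> - L \<theta>0 \<omega>\<close> exceeds \<open>z\<close> at \<open>\<theta> = \<theta>t \<omega>\<close>, hence, since \<open>\<mu> \<ge> \<mu>s\<close>, the supremum
  inside \<open>Q_bound\<close> (with \<open>s = 0\<close>) is at least \<open>exp (\<rho> * \<mu>s * z)\<close>; Markov's inequality gives
  the bound.

  The work lies in measurability. Since \<open>\<theta>t \<omega>\<close> maximizes the field, the event says that the
  excess passes \<open>z\<close> somewhere on \<open>\<Theta>\<close>. This is an uncountable union of measurable events,
  but by separability it differs only by a null set from the union over a countable set
  (\<open>separable_exceedance\<close>), so it is measurable in the completion and has the probability of
  that measurable part. The supremum in \<open>Q_bound\<close> may still fail to be measurable. Its lower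
  integral dominates the integral of every measurable minorant, so Markov's inequality applies
  on each measurable event where the supremum is large (\<open>lower_markov\<close>).
\<close>

text \<open>
  Markov's inequality for lower integrals: for a nonmeasurable \<open>f\<close> the level sets of \<open>f\<close> need
  not be events, so an event \<open>A\<close> on which \<open>f\<close> is at least \<open>c\<close> takes their place. The measurable
  function \<open>c * indicator A\<close> is a minorant of \<open>f\<close>, and the lower integral is monotone.
\<close>

lemma lower_markov:
  fixes f :: "'w \<Rightarrow> ennreal"
  assumes "A \<in> sets M" and "\<And>\<omega>. \<omega> \<in> A \<Longrightarrow> c \<le> f \<omega>"
  shows "c * emeasure M A \<le> (\<integral>\<^sup>+\<omega>. f \<omega> \<partial>M)"
proof -
  have "c * emeasure M A = (\<integral>\<^sup>+\<omega>. c * indicator A \<omega> \<partial>M)"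
    using assms(1) by (simp add: nn_integral_cmult_indicator)
  also have "\<dots> \<le> (\<integral>\<^sup>+\<omega>. f \<omega> \<partial>M)"
    using assms(2) by (intro nn_integral_mono) (auto simp: indicator_def)
  finally show ?thesis .
qed

text \<open>
  Strict exceedance of a level at some \<open>\<theta>\<close> is inherited by the points of \<open>D\<close> along a
  sequence \<open>d\<close> with \<open>L (d n) \<omega> \<longlonglongrightarrow> L \<theta> \<omega>\<close>, so outside the exceptional null set a countable
  union already captures the whole event.
\<close>

lemma separable_exceedance:
  fixes L :: "'a::topological_space \<Rightarrow> 'w \<Rightarrow> real"
  assumes sep: "separable_random_field M \<Theta> L" and [measurable]: "h \<in> borel_measurable M"
  defines "E \<equiv> {\<omega> \<in> space M. \<exists>\<theta>\<in>\<Theta>. h \<omega> < L \<theta> \<omega>}"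
  obtains B where "B \<in> sets M" "B \<subseteq> E" "E \<in> sets (completion M)"
    "emeasure (completion M) E = emeasure M B"
proof -
  from sep obtain D where D: "countable D" "D \<subseteq> \<Theta>"
    and ae: "AE \<omega> in M. \<forall>\<theta>\<in>\<Theta>. \<exists>d. (\<forall>n::nat. d n \<in> D) \<and> d \<longlonglongrightarrow> \<theta> \<and>
           (\<lambda>n. L (d n) \<omega>) \<longlonglongrightarrow> L \<theta> \<omega>"
    and L: "\<And>\<theta>. \<theta> \<in> \<Theta> \<Longrightarrow> L \<theta> \<in> borel_measurable M"
    unfolding separable_random_field_def by blast
  define B where "B = (\<Union>\<theta>\<in>D. {\<omega> \<in> space M. h \<omega> < L \<theta> \<omega>})"
  have B: "B \<in> sets M"
    unfolding B_def using D L by (intro sets.countable_UN') (auto intro!: borel_measurable_less)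
  have BE: "B \<subseteq> E"
    using D by (auto simp: B_def E_def)
  from ae obtain N where N: "N \<in> null_sets M"
    and out: "{\<omega> \<in> space M. \<not> (\<forall>\<theta>\<in>\<Theta>. \<exists>d. (\<forall>n::nat. d n \<in> D) \<and> d \<longlonglongrightarrow> \<theta> \<and>
           (\<lambda>n. L (d n) \<omega>) \<longlonglongrightarrow> L \<theta> \<omega>)} \<subseteq> N"
    by (auto simp: eventually_ae_filter)
  have sub: "E - B \<subseteq> N"
  proof
    fix \<omega> assume \<omega>: "\<omega> \<in> E - B"
    then obtain \<theta> where \<theta>: "\<omega> \<in> space M" "\<theta> \<in> \<Theta>" "h \<omega> < L \<theta> \<omega>"
      by (auto simp: E_def)
    show "\<omega> \<in> N"
    proof (rule ccontr)
      assume "\<omega> \<notin> N"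
      with out \<theta> obtain d where d: "\<And>n::nat. d n \<in> D" "(\<lambda>n. L (d n) \<omega>) \<longlonglongrightarrow> L \<theta> \<omega>"
        by blast
      from order_tendstoD(1)[OF d(2) \<theta>(3)] obtain n where "h \<omega> < L (d n) \<omega>"
        using eventually_happens'[OF sequentially_bot] by blast
      with d(1) \<theta>(1) have "\<omega> \<in> B"
        by (auto simp: B_def)
      with \<omega> show False by simp
    qed
  qed
  have null: "E - B \<in> null_sets (completion M)"
    using sub N by (auto simp: null_sets_completion_iff2)
  have B': "B \<in> sets (completion M)"
    using B by simp
  have E: "E = B \<union> (E - B)"
    using BE by auto
  have "E \<in> sets (completion M)"
    using sets.Un[OF B' null_setsD2[OF null]] E by simp
  moreover have "emeasure (completion M) E = emeasure M B"
    using emeasure_Un_null_set[OF B' null] E B by simp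
  ultimately show thesis
    using that B BE by blast
qed

theorem corollary2p6:
  fixes M :: "'w measure"
    and \<Theta> :: "(real ^ 'p) set"
    and L :: "real ^ 'p \<Rightarrow> 'w \<Rightarrow> real"
    and \<theta>0 :: "real ^ 'p"
    and \<theta>t :: "'w \<Rightarrow> real ^ 'p"
    and \<mu> :: "real ^ 'p \<Rightarrow> real"
    and \<mu>s z \<rho> :: real
  assumes "prob_space M"
    and "separable_random_field M \<Theta> L"
    and "\<And>\<theta>. \<theta> \<in> \<Theta> \<Longrightarrow> integrable M (L \<theta>)"
    and "is_arg_max (\<lambda>\<theta>. \<integral>\<omega>. L \<theta> \<omega> \<partial>M) (\<lambda>\<theta>. \<theta> \<in> \<Theta>) \<theta>0"
    and "\<And>\<omega>. \<omega> \<in> space M \<Longrightarrow> is_arg_max (\<lambda>\<theta>. L \<theta> \<omega>) (\<lambda>\<theta>. \<theta> \<in> \<Theta>) (\<theta>t \<omega>)"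
    and "\<And>\<theta>. \<theta> \<in> \<Theta> \<Longrightarrow> \<mu> \<theta> \<in> Upsilon M L \<theta>0 \<theta>"
    and "0 < \<mu>s"
    and "\<And>\<theta>. \<theta> \<in> \<Theta> \<Longrightarrow> \<mu>s \<le> \<mu> \<theta>"
    and "0 < z"
    and "0 \<le> \<rho>" and "\<rho> < 1"
  shows "{\<omega> \<in> space M. \<theta>0 \<notin> conf_set \<Theta> L \<theta>t z \<omega>} \<in> sets (completion M) \<and>
    emeasure (completion M) {\<omega> \<in> space M. \<theta>0 \<notin> conf_set \<Theta> L \<theta>t z \<omega>}
      \<le> Q_bound M \<Theta> L \<mu> \<theta>0 \<rho> 0 * ennreal (exp (- \<rho> * \<mu>s * z))"
proof -
  have \<theta>0: "\<theta>0 \<in> \<Theta>"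
    using assms(4) by (simp add: is_arg_max_def)
  \<comment> \<open>Nothing is known about \<open>\<theta>t\<close> as a function of \<open>\<omega>\<close>; the maximizing property eliminates it.\<close>
  have ev: "{\<omega> \<in> space M. \<theta>0 \<notin> conf_set \<Theta> L \<theta>t z \<omega>} =
      {\<omega> \<in> space M. \<exists>\<theta>\<in>\<Theta>. L \<theta>0 \<omega> + z < L \<theta> \<omega>}" (is "?bad = ?E")
  proof (intro Collect_cong conj_cong refl)
    fix \<omega> assume "\<omega> \<in> space M"
    from assms(5)[OF this] have t: "\<theta>t \<omega> \<in> \<Theta>" "\<And>\<theta>. \<theta> \<in> \<Theta> \<Longrightarrow> L \<theta> \<omega> \<le> L (\<theta>t \<omega>) \<omega>"
      by (auto simp: is_arg_max_linorder)
    have "\<theta>0 \<notin> conf_set \<Theta> L \<theta>t z \<omega> \<longleftrightarrow> L \<theta>0 \<omega> + z < L (\<theta>t \<omega>) \<omega>"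
      using \<theta>0 by (auto simp: conf_set_def contrast_diff_def)
    also have "\<dots> \<longleftrightarrow> (\<exists>\<theta>\<in>\<Theta>. L \<theta>0 \<omega> + z < L \<theta> \<omega>)"
      using t by (meson order_less_le_trans)
    finally show "\<theta>0 \<notin> conf_set \<Theta> L \<theta>t z \<omega> \<longleftrightarrow> (\<exists>\<theta>\<in>\<Theta>. L \<theta>0 \<omega> + z < L \<theta> \<omega>)" .
  qed
  have "(\<lambda>\<omega>. L \<theta>0 \<omega> + z) \<in> borel_measurable M"
    using assms(3)[OF \<theta>0] by simp
  from separable_exceedance[OF assms(2) this]
  obtain B where B: "B \<in> sets M" "B \<subseteq> ?E" "?E \<in> sets (completion M)"
    "emeasure (completion M) ?E = emeasure M B" .
  let ?c = "exp (\<rho> * \<mu>s * z)"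
  have "ennreal ?c * emeasure M B \<le> Q_bound M \<Theta> L \<mu> \<theta>0 \<rho> 0"
    unfolding Q_bound_def
  proof (rule lower_markov[OF B(1)])
    fix \<omega> assume "\<omega> \<in> B"
    with B(2) obtain \<theta> where \<theta>: "\<theta> \<in> \<Theta>" "z < contrast_diff L \<theta> \<theta>0 \<omega>"
      by (auto simp: contrast_diff_def)
    have "\<mu>s * z \<le> \<mu> \<theta> * contrast_diff L \<theta> \<theta>0 \<omega>"
      using assms(8)[OF \<theta>(1)] \<theta>(2) assms(7,9) by (intro mult_mono) auto
    then have "\<rho> * \<mu>s * z \<le> \<rho> * (\<mu> \<theta> * contrast_diff L \<theta> \<theta>0 \<omega> + 0 * rate_fun M L \<mu> \<theta> \<theta>0)"
      using assms(10) by (simp add: mult.assoc mult_left_mono)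
    then show "ennreal ?c \<le> (SUP \<theta>\<in>\<Theta>. ennreal (exp (\<rho> *
        (\<mu> \<theta> * contrast_diff L \<theta> \<theta>0 \<omega> + 0 * rate_fun M L \<mu> \<theta> \<theta>0))))"
      by (intro SUP_upper2[OF \<theta>(1)] ennreal_leI) simp
  qed
  then have "ennreal ?c * emeasure M B * ennreal (exp (- \<rho> * \<mu>s * z))
      \<le> Q_bound M \<Theta> L \<mu> \<theta>0 \<rho> 0 * ennreal (exp (- \<rho> * \<mu>s * z))"
    by (rule mult_right_mono) simp
  moreover have "ennreal ?c * emeasure M B * ennreal (exp (- \<rho> * \<mu>s * z)) = emeasure M B"
  proof -
    have "ennreal ?c * ennreal (exp (- \<rho> * \<mu>s * z)) = 1"
      by (simp add: ennreal_mult[symmetric] exp_minus)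
    then show ?thesis
      by (metis mult.assoc mult.commute mult_1)
  qed
  ultimately show ?thesis
    using B(3,4) by (simp add: ev)
qed

end
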